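(* Let $B \subset \mathbb{R}^{2d}$ be a convex body and let $C_1, \ldots, C_n \subset \mathbb{R}^{2d}$ be convex sets that permit a translative covering of $B$. Assume that for every $i \in \{1,\ldots,n\}$ there exists some $o_i \in \mathbb{R}^{2d}$ such that $r_B(C_i) B - o_i$ and $C_i - o_i$ have a complete set of contact pairs all of which are of the form $(w, \widehat{w})$ with $w \in \mathbb{R}^{2d}$. Then $$\sum_{i=1}^n r_B(C_i) \ge 1.$$
   Context: Identify $\mathbb{R}^{2d} = \mathbb{R}^d \times \mathbb{R}^d$; for $w = (u,v)$ with $u,v \in \mathbb{R}^d$, put $\widehat{w} = (v,u)$. A convex body is a compact convex set with nonempty interior. Convex sets $C_1,\ldots,C_n \subset \mathbb{R}^{2d}$ permit a translative covering of a convex body $B$ if $B \subset \bigcup_{i=1}^n (C_i + x_i)$ for some $x_1,\ldots,x_n \in \mathbb{R}^{2d}$. For a convex body $K \subset \mathbb{R}^{2d}$ and a convex set $L \subset \mathbb{R}^{2d}$, the $K$-inradius of $L$ is $r_K(L) = \sup\{\lambda \ge 0 : \lambda K + x \subset L \text{ for some } x \in \mathbb{R}^{2d}\}$. Contact pairs: let $K'$ be a maximal homothetic copy of a convex body $K$ inscribed in a convex set $L$ (i.e. $K' \subset L$ is a translate of $r_K(L) K$). A contact pair of $K'$ and $L$ is a pair $(p,q)$ with $p \in \mathbb{R}^{2d}$, $q \in \mathbb{R}^{2d} \setminus \{0\}$, where $p$ is a common boundary point of $K'$ and $L$ and $q$ is a common outer normal vector of $K'$ and $L$ at $p$ (i.e.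 $\langle x, q\rangle \le \langle p, q \rangle$ for all $x \in L$, hence for all $x \in K'$). A finite set of contact pairs $\{(p_1,q_1),\ldots,(p_m,q_m)\}$ is complete if $0 \in \operatorname{conv}\{q_1,\ldots,q_m\}$. In the hypothesis, these notions are applied with $K = B$, $K' = r_B(C_i)B - o_i$ and $L = C_i - o_i$. *)

theory Defs
  imports "HOL-Analysis.Analysis"
begin

definition convex_body :: "'a::euclidean_space set \<Rightarrow> bool" where
  "convex_body K \<longleftrightarrow> compact K \<and> convex K \<and> interior K \<noteq> {}"

definition permits_translative_covering ::
    "nat \<Rightarrow> (nat \<Rightarrow> 'a::euclidean_space set) \<Rightarrow> 'a set \<Rightarrow> bool" where
  "permits_translative_covering n C B \<longleftrightarrow>
     (\<exists>x. B \<subseteq> (\<Union>i\<in>{1..n}. (\<lambda>y. y + x i) ` C i))"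

text \<open>
  The real supremum is unspecified if \<open>L\<close> is empty or contains arbitrarily large
  homothetic copies of \<open>K\<close>. For a convex body \<open>K\<close> neither case is compatible with the
  predicate \<open>complete_contact_pairs\<close> together with \<open>maximal_inscribed_copy\<close> below: the latter
  contains \<open>K' \<subseteq> L\<close>, and the former bounds the support function of \<open>L\<close>
  in directions having the origin in their convex hull.
\<close>
definition inradius :: "'a::euclidean_space set \<Rightarrow> 'a set \<Rightarrow> real" where
  "inradius K L = Sup {l. 0 \<le> l \<and> (\<exists>x. (\<lambda>y. l *\<^sub>R y + x) ` K \<subseteq> L)}"

definition maximal_inscribed_copy ::
    "'a::euclidean_space set \<Rightarrow> 'a set \<Rightarrow> 'a set \<Rightarrow> bool" where
  "maximal_inscribed_copy K K' L \<longleftrightarrow>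
     K' \<subseteq> L \<and> (\<exists>x. K' = (\<lambda>y. inradius K L *\<^sub>R y + x) ` K)"

definition outer_normal :: "'a::euclidean_space set \<Rightarrow> 'a \<Rightarrow> 'a \<Rightarrow> bool" where
  "outer_normal L p q \<longleftrightarrow> q \<noteq> 0 \<and> (\<forall>x\<in>L. x \<bullet> q \<le> p \<bullet> q)"

definition contact_pair ::
    "'a::euclidean_space set \<Rightarrow> 'a set \<Rightarrow> 'a \<times> 'a \<Rightarrow> bool" where
  "contact_pair K' L = (\<lambda>(p, q).
     p \<in> frontier K' \<and> p \<in> frontier L \<and> outer_normal K' p q \<and> outer_normal L p q)"

definition complete_contact_pairs ::
    "'a::euclidean_space set \<Rightarrow> 'a set \<Rightarrow> ('a \<times> 'a) set \<Rightarrow> bool" where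
  "complete_contact_pairs K' L P \<longleftrightarrow>
     finite P \<and> (\<forall>pq\<in>P. contact_pair K' L pq) \<and> 0 \<in> convex hull (snd ` P)"

definition hat :: "'v \<times> 'v \<Rightarrow> 'v \<times> 'v" where
  "hat w = (snd w, fst w)"

end

theory Submission
  imports Defs
begin

text \<open>
  The form \<open>\<langle>x, hat y\<rangle>\<close> is symmetric, so Bang's argument for planks applies to it. Suppose
  \<open>\<Sum>r\<^sub>i < 1\<close> and pick one contact point \<open>w\<^sub>i\<close> for every \<open>i\<close>. Up to a fixed translation, all sums
  \<open>\<Sum>w\<^sub>i\<close> lie in \<open>B\<close>, even after each \<open>w\<^sub>i\<close> is pushed outwards slightly. Choose the \<open>w\<^sub>i\<close> to
  maximise a quadratic function that is affine in each \<open>w\<^sub>i\<close> separately. Since the normals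
  \<open>hat w\<close> have \<open>0\<close> in their convex hull, the resulting point lies strictly beyond the supporting
  hyperplane of the \<open>i\<close>th translate at the selected contact point, for every \<open>i\<close>.
\<close>

text \<open>Otherwise the convex set \<open>{q. h \<bullet> q < 0}\<close> would contain the hull of
  \<open>Q\<close>, and hence 0. This is how completeness of contact pairs enters every later
  argument.\<close>

lemma zero_in_hull_obtains_inner_nonneg:
  fixes h :: "'a::real_inner"
  assumes "0 \<in> convex hull Q"
  obtains q where "q \<in> Q" "0 \<le> h \<bullet> q"
proof (rule ccontr)
  assume "\<not> thesis"
  then have "Q \<subseteq> {q. h \<bullet> q < 0}"
    using that by force
  then have "convex hull Q \<subseteq> {q. h \<bullet> q < 0}"
    by (rule hull_minimal) (rule convex_halfspace_lt)
  with assms show False by auto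
qed

text \<open>At a maximiser of \<open>F\<close> over the finite product of the \<open>W i\<close>,
  replacing \<open>w i\<close> by any \<open>v\<close> in \<open>W i\<close> does not increase
  \<open>F\<close>, while the hull condition supplies a \<open>v\<close> with
  \<open>0 \<le> h \<bullet> T v\<close>. The free vectors \<open>c i\<close> later absorb the
  translations of the covering.\<close>

lemma bang_selection:
  fixes T :: "'a::real_inner \<Rightarrow> 'a"
  assumes I: "finite I"
    and W: "\<And>i. i \<in> I \<Longrightarrow> finite (W i)"
    and hull: "\<And>i. i \<in> I \<Longrightarrow> 0 \<in> convex hull (T ` W i)"
    and T: "linear T" and sym: "\<And>x y. T x \<bullet> y = x \<bullet> T y"
  obtains w where "\<And>i. i \<in> I \<Longrightarrow> w i \<in> W i"
    and "\<And>i. i \<in> I \<Longrightarrow> 0 \<le> (sum w (I - {i}) + c i) \<bullet> T (w i)"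
proof -
  \<comment> \<open>Removing the diagonal terms makes \<open>F\<close> affine in each
    \<open>w i\<close>. By symmetry of \<open>T\<close> each cross term occurs twice, hence the
    factor 1/2.\<close>
  define F where "F w = (sum w I \<bullet> T (sum w I) - (\<Sum>i\<in>I. w i \<bullet> T (w i))) / 2
      + (\<Sum>i\<in>I. c i \<bullet> T (w i))" for w
  have ne: "W i \<noteq> {}" if "i \<in> I" for i
    using hull[OF that] by auto
  have fin: "finite (PiE I W)"
    using I W by (rule finite_PiE)
  have "PiE I W \<noteq> {}"
    using ne by (simp add: PiE_eq_empty_iff)
  with fin have "Max (F ` PiE I W) \<in> F ` PiE I W"
    by (intro Max_in) auto
  then obtain w where w: "w \<in> PiE I W" and wM: "F w = Max (F ` PiE I W)"
    by force
  have max: "F v \<le> F w" if "v \<in> PiE I W" for v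
    unfolding wM using fin that by (intro Max_ge) auto
  show thesis
  proof
    fix i assume i: "i \<in> I"
    show "w i \<in> W i"
      using w i by auto
    define h where "h = sum w (I - {i}) + c i"
    obtain v where v: "v \<in> W i" "0 \<le> h \<bullet> T v"
      using zero_in_hull_obtains_inner_nonneg[OF hull[OF i], of h] by blast
    define R where "R = sum w (I - {i})"
    \<comment> \<open>Only the first summand depends on \<open>u i\<close>, so comparing
      \<open>F\<close> at \<open>w(i := v)\<close> and at \<open>w\<close> compares
      \<open>h \<bullet> T v\<close> with \<open>h \<bullet> T (w i)\<close>.\<close>
    have F_eq: "F u = h \<bullet> T (u i)
        + (R \<bullet> T R - (\<Sum>k\<in>I - {i}. w k \<bullet> T (w k))) / 2 + (\<Sum>k\<in>I - {i}. c k \<bullet> T (w k))"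
      if u: "\<And>k. k \<noteq> i \<Longrightarrow> u k = w k" for u
    proof -
      have "u i \<bullet> T R = R \<bullet> T (u i)"
        by (metis sym inner_commute)
      moreover have "sum u I = u i + R"
        "(\<Sum>k\<in>I. u k \<bullet> T (u k)) = u i \<bullet> T (u i) + (\<Sum>k\<in>I - {i}. w k \<bullet> T (w k))"
        "(\<Sum>k\<in>I. c k \<bullet> T (u k)) = c i \<bullet> T (u i) + (\<Sum>k\<in>I - {i}. c k \<bullet> T (w k))"
        unfolding R_def by (auto simp: sum.remove[OF I i] u intro!: sum.cong)
      ultimately show ?thesis
        unfolding F_def h_def R_def[symmetric]
        by (simp add: linear_add[OF T] inner_left_distrib inner_right_distrib field_simps)
    qed
    have "w(i := v) \<in> PiE I W"
      using w v i by (auto simp: PiE_iff extensional_def)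
    from max[OF this] have "h \<bullet> T v \<le> h \<bullet> T (w i)"
      by (simp add: F_eq)
    with v show "0 \<le> (sum w (I - {i}) + c i) \<bullet> T (w i)"
      by (simp add: h_def)
  qed
qed

lemma interior_point_obtains_inner_less:
  fixes z q :: "'a::euclidean_space"
  assumes "z \<in> interior B" "q \<noteq> 0"
  obtains y where "y \<in> B" "z \<bullet> q < y \<bullet> q"
proof -
  obtain e where e: "e > 0" "cball z e \<subseteq> B"
    using assms(1) by (auto simp: mem_interior_cball)
  show thesis
  proof
    show "z + (e / norm q) *\<^sub>R q \<in> B"
      using e assms(2) by (intro subsetD[OF e(2)]) (simp add: dist_norm)
    show "z \<bullet> q < (z + (e / norm q) *\<^sub>R q) \<bullet> q"
      using e(1) assms(2) by (simp add: inner_left_distrib)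
  qed
qed

text \<open>Some \<open>q\<close> in \<open>Q\<close> has a nonnegative product with the image of an
  interior point \<open>z\<close>. In that direction the copy reaches beyond this image by a
  positive multiple of its ratio, while \<open>L\<close> is bounded there. This makes the
  \<open>Sup\<close> in \<open>inradius\<close> a genuine supremum.\<close>

lemma bdd_above_inscribed_ratios:
  fixes B L :: "'a::euclidean_space set"
  assumes B: "interior B \<noteq> {}"
    and Q: "finite Q" "0 \<notin> Q" "0 \<in> convex hull Q"
    and bound: "\<And>q. q \<in> Q \<Longrightarrow> \<exists>M. \<forall>x\<in>L. x \<bullet> q \<le> M"
  shows "bdd_above {l. 0 \<le> l \<and> (\<exists>x. (\<lambda>y. l *\<^sub>R y + x) ` B \<subseteq> L)}"
proof -
  obtain z where z: "z \<in> interior B"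
    using B by auto
  obtain M where M: "\<And>q x. q \<in> Q \<Longrightarrow> x \<in> L \<Longrightarrow> x \<bullet> q \<le> M q"
    using bound by metis
  have "\<exists>y\<in>B. z \<bullet> q < y \<bullet> q" if "q \<in> Q" for q
    using interior_point_obtains_inner_less[OF z, of q] that Q(2) by metis
  then obtain Y where Y: "\<And>q. q \<in> Q \<Longrightarrow> Y q \<in> B" "\<And>q. q \<in> Q \<Longrightarrow> z \<bullet> q < Y q \<bullet> q"
    by metis
  define f where "f q = M q / ((Y q - z) \<bullet> q)" for q
  have "l \<le> Max (f ` Q)" if l: "0 \<le> l" "(\<lambda>y. l *\<^sub>R y + x) ` B \<subseteq> L" for l x
  proof -
    obtain q where q: "q \<in> Q" "0 \<le> (l *\<^sub>R z + x) \<bullet> q"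
      using zero_in_hull_obtains_inner_nonneg[OF Q(3)] by blast
    have "(l *\<^sub>R Y q + x) \<bullet> q \<le> M q"
      using M l(2) Y(1) q(1) by blast
    with q have "l * ((Y q - z) \<bullet> q) \<le> M q"
      by (simp add: inner_left_distrib inner_diff_left algebra_simps)
    then have "l \<le> f q"
      using Y(2)[OF q(1)] by (simp add: f_def pos_le_divide_eq inner_diff_left)
    \<comment> \<open>The direction \<open>q\<close> depends on the copy; the maximum over the
      finite set \<open>Q\<close> gives a uniform bound.\<close>
    also have "\<dots> \<le> Max (f ` Q)"
      using Q(1) q(1) by simp
    finally show ?thesis .
  qed
  then show ?thesis
    by (intro bdd_aboveI[of _ "Max (f ` Q)"]) auto
qed

lemma linear_hat: "linear (hat :: ('v::real_vector \<times> 'v) \<Rightarrow> _)"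
  by (rule linearI) (auto simp: hat_def)

lemma inner_hat_sym:
  fixes x y :: "'v::real_inner \<times> 'v"
  shows "hat x \<bullet> y = x \<bullet> hat y"
  by (simp add: hat_def inner_prod_def)

lemma contact_points_properties:
  fixes B C :: "('v::euclidean_space \<times> 'v) set"
  assumes B: "convex_body B"
    and sub: "(\<lambda>y. inradius B C *\<^sub>R y - a) ` B \<subseteq> (\<lambda>y. y - a) ` C"
    and P: "complete_contact_pairs ((\<lambda>y. inradius B C *\<^sub>R y - a) ` B) ((\<lambda>y. y - a) ` C) P"
    and form: "\<forall>pq\<in>P. \<exists>w. pq = (w, hat w)"
    and z: "z \<in> interior B"
  shows "finite (fst ` P)"
    and "0 \<in> convex hull (hat ` fst ` P)"
    and "inradius B C > 0"
    and "w \<in> fst ` P \<Longrightarrow> w \<in> (\<lambda>y. inradius B C *\<^sub>R y - a) ` B"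
    and "w \<in> fst ` P \<Longrightarrow> y \<in> C \<Longrightarrow> (y - a) \<bullet> hat w \<le> w \<bullet> hat w"
    and "w \<in> fst ` P \<Longrightarrow> (inradius B C *\<^sub>R z - a) \<bullet> hat w < w \<bullet> hat w"
proof -
  let ?r = "inradius B C"
  let ?K = "(\<lambda>y. ?r *\<^sub>R y - a) ` B"
  show fin: "finite (fst ` P)"
    using P by (simp add: complete_contact_pairs_def)
  have "snd ` P = hat ` fst ` P"
    unfolding image_image using form by (intro image_cong) auto
  then show hull: "0 \<in> convex hull (hat ` fst ` P)"
    using P by (simp add: complete_contact_pairs_def)
  have cp: "contact_pair ?K ((\<lambda>y. y - a) ` C) (w, hat w)" if "w \<in> fst ` P" for w
    using P form that by (force simp: complete_contact_pairs_def)
  have "compact ?K"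
    using B unfolding convex_body_def
    by (intro compact_continuous_image continuous_intros) auto
  then have inK: "w \<in> ?K" if "w \<in> fst ` P" for w
    using cp[OF that] by (simp add: contact_pair_def compact_imp_closed frontier_def)
  then show "w \<in> fst ` P \<Longrightarrow> w \<in> ?K" .
  have nz: "hat w \<noteq> 0" if "w \<in> fst ` P" for w
    using cp[OF that] by (simp add: contact_pair_def outer_normal_def)
  have outC: "(y - a) \<bullet> hat w \<le> w \<bullet> hat w" if "w \<in> fst ` P" "y \<in> C" for w y
    using cp[OF that(1)] that(2) by (simp add: contact_pair_def outer_normal_def)
  then show "w \<in> fst ` P \<Longrightarrow> y \<in> C \<Longrightarrow> (y - a) \<bullet> hat w \<le> w \<bullet> hat w" .
  have outK: "(?r *\<^sub>R y - a) \<bullet> hat w \<le> w \<bullet> hat w" if "w \<in> fst ` P" "y \<in> B" for w y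
    using cp[OF that(1)] that(2) by (simp add: contact_pair_def outer_normal_def)
  have zB: "z \<in> B"
    using z interior_subset by blast
  let ?S = "{l. 0 \<le> l \<and> (\<exists>x. (\<lambda>y. l *\<^sub>R y + x) ` B \<subseteq> C)}"
  have "bdd_above ?S"
  proof (rule bdd_above_inscribed_ratios[OF _ _ _ hull])
    show "interior B \<noteq> {}"
      using z by blast
    show "finite (hat ` fst ` P)"
      using fin by (rule finite_imageI)
    show "0 \<notin> hat ` fst ` P"
      using nz by (metis imageE)
    show "\<exists>M. \<forall>x\<in>C. x \<bullet> q \<le> M" if q: "q \<in> hat ` fst ` P" for q
    proof -
      obtain w where w: "q = hat w" "w \<in> fst ` P"
        using q by (rule imageE)
      then have "\<forall>x\<in>C. x \<bullet> q \<le> w \<bullet> q + a \<bullet> q"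
        using outC[OF w(2)] by (simp add: inner_diff_left diff_le_eq)
      then show ?thesis ..
    qed
  qed
  moreover obtain c where "c \<in> C"
    using sub zB by blast
  then have "(\<lambda>y. 0 *\<^sub>R y + c) ` B \<subseteq> C"
    by auto
  then have "0 \<in> ?S"
    by blast
  ultimately have r0: "?r \<ge> 0"
    unfolding inradius_def by (intro cSup_upper)
  \<comment> \<open>If the ratio were 0, the inscribed copy would be the single point
    \<open>- a\<close>, so all normals would equal the nonzero vector \<open>hat (- a)\<close> and 0
    could not lie in their hull.\<close>
  have "?r \<noteq> 0"
  proof
    assume r: "?r = 0"
    obtain q where q: "q \<in> hat ` fst ` P" "0 \<le> (- hat (- a)) \<bullet> q"
      using zero_in_hull_obtains_inner_nonneg[OF hull] by blast
    obtain w where w: "q = hat w" "w \<in> fst ` P"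
      using q(1) by (rule imageE)
    moreover have "w = - a"
      using inK[OF w(2)] r by auto
    ultimately show False
      using q(2) nz[OF w(2)] by (simp flip: inner_gt_zero_iff)
  qed
  with r0 show r: "?r > 0"
    by simp
  assume w: "w \<in> fst ` P"
  obtain y where y: "y \<in> B" "z \<bullet> hat w < y \<bullet> hat w"
    using interior_point_obtains_inner_less[OF z nz[OF w]] by blast
  then have "(?r *\<^sub>R z - a) \<bullet> hat w < (?r *\<^sub>R y - a) \<bullet> hat w"
    using r by (simp add: inner_diff_left)
  with outK[OF w y(1)] show "(?r *\<^sub>R z - a) \<bullet> hat w < w \<bullet> hat w"
    by simp
qed

text \<open>The weight missing from 1 goes to \<open>z\<close>, which is adjoined to the family
  under the extra index \<open>None\<close>.\<close>

lemma convex_subconvex_sum_mem: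
  fixes B :: "'a::real_vector set"
  assumes "convex B" "finite I" "z \<in> B"
    and "\<And>i. i \<in> I \<Longrightarrow> y i \<in> B" "\<And>i. i \<in> I \<Longrightarrow> 0 \<le> t i" "sum t I \<le> 1"
  shows "(\<Sum>i\<in>I. t i *\<^sub>R y i) + (1 - sum t I) *\<^sub>R z \<in> B"
proof -
  let ?J = "insert None (Some ` I)"
  let ?t = "case_option (1 - sum t I) t" and ?y = "case_option z y"
  have "(\<Sum>j\<in>?J. ?t j *\<^sub>R ?y j) \<in> B"
    using assms by (intro convex_sum) (auto simp: sum.reindex)
  also have "(\<Sum>j\<in>?J. ?t j *\<^sub>R ?y j) = (\<Sum>i\<in>I. t i *\<^sub>R y i) + (1 - sum t I) *\<^sub>R z"
    using assms(2) by (simp add: sum.reindex)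
  finally show ?thesis .
qed

theorem proposition1:
  fixes B :: "((real ^ 'd) \<times> (real ^ 'd)) set"
    and C :: "nat \<Rightarrow> ((real ^ 'd) \<times> (real ^ 'd)) set"
    and n :: nat
  assumes "convex_body B"
    and "\<forall>i\<in>{1..n}. convex (C i)"
    and "permits_translative_covering n C B"
    and "\<forall>i\<in>{1..n}. \<exists>a.
           maximal_inscribed_copy B ((\<lambda>y. inradius B (C i) *\<^sub>R y - a) ` B) ((\<lambda>y. y - a) ` C i) \<and>
           (\<exists>P. complete_contact_pairs
                  ((\<lambda>y. inradius B (C i) *\<^sub>R y - a) ` B) ((\<lambda>y. y - a) ` C i) P \<and>
                (\<forall>pq\<in>P. \<exists>w. pq = (w, hat w)))"
  shows "(\<Sum>i = 1..n. inradius B (C i)) \<ge> 1"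
proof (rule ccontr)
  let ?I = "{1..n}"
  define r where "r i = inradius B (C i)" for i
  define R where "R = sum r ?I"
  assume "\<not> ?thesis"
  then have R1: "R < 1"
    by (simp add: R_def r_def)
  obtain z where z: "z \<in> interior B"
    using assms(1) by (auto simp: convex_body_def)
  then have zB: "z \<in> B"
    using interior_subset by blast
  have convB: "convex B"
    using assms(1) by (simp add: convex_body_def)
  obtain x where x: "B \<subseteq> (\<Union>i\<in>?I. (\<lambda>y. y + x i) ` C i)"
    using assms(3) by (auto simp: permits_translative_covering_def)
  obtain a P where aP: "\<And>i. i \<in> ?I \<Longrightarrow>
      (\<lambda>y. inradius B (C i) *\<^sub>R y - a i) ` B \<subseteq> (\<lambda>y. y - a i) ` C i \<and>
      complete_contact_pairs
        ((\<lambda>y. inradius B (C i) *\<^sub>R y - a i) ` B) ((\<lambda>y. y - a i) ` C i) (P i) \<and>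
      (\<forall>pq\<in>P i. \<exists>w. pq = (w, hat w))"
    using assms(4) unfolding maximal_inscribed_copy_def by metis
  define W where "W i = fst ` P i" for i
  note props = contact_points_properties[OF assms(1) _ _ _ z, folded r_def]
  have W: "finite (W i)" "0 \<in> convex hull (hat ` W i)" "r i > 0"
    "\<And>w. w \<in> W i \<Longrightarrow> w \<in> (\<lambda>y. r i *\<^sub>R y - a i) ` B"
    "\<And>w y. w \<in> W i \<Longrightarrow> y \<in> C i \<Longrightarrow> (y - a i) \<bullet> hat w \<le> w \<bullet> hat w"
    "\<And>w. w \<in> W i \<Longrightarrow> (r i *\<^sub>R z - a i) \<bullet> hat w < w \<bullet> hat w"
    if "i \<in> ?I" for i
    using props[of "C i" "a i" "P i"] aP[OF that] unfolding W_def r_def by blast+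
  have R0: "0 \<le> R"
    unfolding R_def using W(3) by (intro sum_nonneg) (simp add: less_imp_le)
  \<comment> \<open>With this choice \<open>(1 + e) * R = 1 - (1 - R)^2\<close>, so the weights
    \<open>r i\<close> enlarged by the factor \<open>1 + e\<close> still sum to at most 1.\<close>
  define e where "e = 1 - R"
  have e: "0 < e" "(1 + e) * R \<le> 1"
    using R1 zero_le_power2[of "1 - R"] by (simp_all add: e_def power2_eq_square algebra_simps)
  \<comment> \<open>\<open>\<zeta> i\<close> is interior to the inscribed copy, and \<open>w i\<close> is pushed away from it to
    \<open>w i + e *\<^sub>R (w i - \<zeta> i)\<close>; the vector \<open>s\<close> brings the sum of these points into \<open>B\<close>.\<close>
  define \<zeta> where "\<zeta> i = r i *\<^sub>R z - a i" for i
  define s where "s = sum a ?I + (1 - R) *\<^sub>R z"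
  \<comment> \<open>This value is obtained by solving \<open>p - x i - a i = w i + e *\<^sub>R (w i
    - \<zeta> i) + (1 + e) *\<^sub>R (sum w (?I - {i}) + c i)\<close> for \<open>c i\<close>, with
    \<open>p\<close> as defined below.\<close>
  define c where "c i = (1 / (1 + e)) *\<^sub>R (s - e *\<^sub>R sum \<zeta> (?I - {i}) - x i - a i)" for i
  obtain w where w: "\<And>i. i \<in> ?I \<Longrightarrow> w i \<in> W i"
    and pos: "\<And>i. i \<in> ?I \<Longrightarrow> 0 \<le> (sum w (?I - {i}) + c i) \<bullet> hat (w i)"
    using bang_selection[of ?I W hat c] W(1,2) linear_hat inner_hat_sym by blast
  define p where "p = (1 + e) *\<^sub>R sum w ?I - e *\<^sub>R sum \<zeta> ?I + s"
  have "p \<in> B"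
  proof -
    have "\<forall>i\<in>?I. \<exists>y\<in>B. w i = r i *\<^sub>R y - a i"
      using W(4) w by blast
    then obtain y where y: "\<And>i. i \<in> ?I \<Longrightarrow> y i \<in> B \<and> w i = r i *\<^sub>R y i - a i"
      by metis
    have sw: "sum w ?I = (\<Sum>i\<in>?I. r i *\<^sub>R y i) - sum a ?I"
      unfolding sum_subtractf[symmetric] using y by (intro sum.cong) auto
    have sz: "sum \<zeta> ?I = R *\<^sub>R z - sum a ?I"
      by (simp add: \<zeta>_def R_def sum_subtractf scaleR_left.sum)
    have st: "(\<Sum>i\<in>?I. (1 + e) * r i) = (1 + e) * R"
      by (simp add: R_def sum_distrib_left)
    \<comment> \<open>The shifts \<open>a i\<close> cancel, and the coefficient of \<open>z\<close>
      is \<open>1 - R - e * R\<close>, exactly the missing weight.\<close>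
    have "p = (\<Sum>i\<in>?I. ((1 + e) * r i) *\<^sub>R y i) + (1 - (\<Sum>i\<in>?I. (1 + e) * r i)) *\<^sub>R z"
      unfolding st p_def sw sz s_def scaleR_scaleR[symmetric] scaleR_right.sum[symmetric]
      by (simp add: algebra_simps)
    also have "\<dots> \<in> B"
      using y W(3) e by (intro convex_subconvex_sum_mem convB zB) (auto simp: st[simplified] less_imp_le)
    finally show ?thesis .
  qed
  then obtain i where i: "i \<in> ?I" and "p \<in> (\<lambda>y. y + x i) ` C i"
    using x by blast
  then have "p - x i \<in> C i"
    by auto
  then have le: "(p - x i - a i) \<bullet> hat (w i) \<le> w i \<bullet> hat (w i)"
    using W(5) i w by blast
  have "sum w ?I = w i + sum w (?I - {i})" "sum \<zeta> ?I = \<zeta> i + sum \<zeta> (?I - {i})"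
    using i by (simp_all add: sum.remove)
  then have "p - x i - a i = w i + e *\<^sub>R (w i - \<zeta> i) + (1 + e) *\<^sub>R (sum w (?I - {i}) + c i)"
    using e(1) by (simp add: p_def c_def scaleR_add_right) (simp add: algebra_simps)
  \<comment> \<open>The outward push contributes a positive term and the selection a nonnegative
    one, so \<open>p\<close> violates the supporting inequality of the very translate that covers
    it.\<close>
  then have "(p - x i - a i) \<bullet> hat (w i) = w i \<bullet> hat (w i)
      + e * ((w i - \<zeta> i) \<bullet> hat (w i)) + (1 + e) * ((sum w (?I - {i}) + c i) \<bullet> hat (w i))"
    by (simp only: inner_left_distrib inner_scaleR_left)
  moreover have "0 < e * ((w i - \<zeta> i) \<bullet> hat (w i))"
    using e(1) W(6)[OF i w[OF i]] by (simp add: \<zeta>_def inner_diff_left)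
  moreover have "0 \<le> (1 + e) * ((sum w (?I - {i}) + c i) \<bullet> hat (w i))"
    using e(1) pos[OF i] by simp
  ultimately show False
    using le by linarith
qed

end
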